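(* Let $m, r$ and $d$ be integers such that $d \geq 1$ and $2 \leq 2r \leq m-1$. If $d_1, d_2, \ldots, d_r$ are any integers such that $d\ge d_i\ge d/2$ for $i=1,\ldots,r$, then $$ \mathcal{A}(d_1,\ldots,d_r)\subseteq \overline{\mathcal{A}\left(\left\lceil \tfrac{d}{2}\right\rceil,\ldots,\left\lceil \tfrac{d}{2}\right\rceil\right)}, $$ where $\lceil d/2\rceil$ appears $r$ times as an argument of $\mathcal{A}$ on the right-hand side.
   Context: All matrix polynomials have coefficients in $\mathbb{C}$. $\mathrm{POL}^{p\times q}$ is the set of all $p\times q$ matrix polynomials. $\Delta_r$ is the $r\times r$ matrix with ones on the anti-diagonal and zeros elsewhere. $L_{*i}$ denotes the $i$-th column of $L(\lambda)$; the degree of a vector polynomial is the largest power of $\lambda$ with a nonzero vector coefficient (so a vector polynomial whose degree is a nonnegative integer is nonzero). For integers $d_1,\ldots,d_r$ with $d\ge d_i\ge d/2$ for $i=1,\ldots,r$, $$ \mathcal{A}(d_1,\ldots,d_r) := \left\{ L(\lambda)\begin{bmatrix} 0 & \Delta_r\\ -\Delta_r & 0\end{bmatrix} L(\lambda)^T \; : \; \begin{array}{l} L(\lambda)\in\mathrm{POL}^{m\times 2r},\\ \deg(L_{*i})=d_i \text{ and } \deg(L_{*(2r-i+1)})=d-d_i \text{ for } i=1,\ldots,r\end{array}\right\}. $$ These are subsets of $\mathrm{POL}^{ss}_{d,m}$, the vector space of $m\times m$ skew-symmetric matrix polynomials $P(\lambda)=\sum_{i=0}^d\lambda^iA_i$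 ($A_i^T=-A_i\in\mathbb{C}^{m\times m}$) of degree at most $d$, equipped with the distance $d(P,P')=\left(\sum_{i=0}^d\|A_i-A_i'\|_F^2\right)^{1/2}$, where $P'(\lambda)=\sum_{i=0}^d\lambda^iA_i'$. $\overline{\mathcal{S}}$ denotes closure in $\mathrm{POL}^{ss}_{d,m}$ with the resulting (Euclidean) topology. *)

theory Defs
  imports
    "HOL-Analysis.L2_Norm"
    "HOL-Analysis.Abstract_Metric_Spaces"
    "HOL-Computational_Algebra.Polynomial"
    "Jordan_Normal_Form.Matrix"
begin

text \<open>
  A \<open>p \<times> q\<close> matrix polynomial is an element of \<open>carrier_mat p q\<close> with entries in
  \<open>complex poly\<close>; rows and columns are indexed from 0.
\<close>

definition coeff_mat :: "complex poly mat \<Rightarrow> nat \<Rightarrow> complex mat" where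
  "coeff_mat P k = map_mat (\<lambda>p. coeff p k) P"

definition coeff_vec :: "complex poly vec \<Rightarrow> nat \<Rightarrow> complex vec" where
  "coeff_vec v k = map_vec (\<lambda>p. coeff p k) v"

text \<open>
  A relation rather than a function, so that the zero vector polynomial has no degree in
  \<open>nat\<close>.
\<close>

definition has_vec_degree :: "complex poly vec \<Rightarrow> nat \<Rightarrow> bool" where
  "has_vec_degree v n \<longleftrightarrow>
     coeff_vec v n \<noteq> 0\<^sub>v (dim_vec v) \<and> (\<forall>k>n. coeff_vec v k = 0\<^sub>v (dim_vec v))"

definition antidiag_mat :: "nat \<Rightarrow> complex poly mat" where
  "antidiag_mat r = mat r r (\<lambda>(i, j). if i + j + 1 = r then 1 else 0)"

definition skew_block_mat :: "nat \<Rightarrow> complex poly mat" where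
  "skew_block_mat r =
     four_block_mat (0\<^sub>m r r) (antidiag_mat r) (- antidiag_mat r) (0\<^sub>m r r)"

definition pol_ss :: "nat \<Rightarrow> nat \<Rightarrow> complex poly mat set" where
  "pol_ss d m =
     {P \<in> carrier_mat m m.
        (\<forall>k. transpose_mat (coeff_mat P k) = - coeff_mat P k) \<and>
        (\<forall>k>d. coeff_mat P k = 0\<^sub>m m m)}"

text \<open>
  The inner double sum is the squared Frobenius norm of \<open>coeff_mat P k - coeff_mat Q k\<close>. It is
  written entrywise because matrix subtraction takes its dimensions from the second argument,
  whereas \<open>Metric_space\<close> asks for symmetry on the whole type.
\<close>

definition pol_dist :: "nat \<Rightarrow> nat \<Rightarrow> complex poly mat \<Rightarrow> complex poly mat \<Rightarrow> real" where
  "pol_dist d m P Q =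
     sqrt (\<Sum>k\<le>d. \<Sum>i<m. \<Sum>j<m. (cmod (coeff (P $$ (i, j)) k - coeff (Q $$ (i, j)) k))\<^sup>2)"

definition pol_ss_topology :: "nat \<Rightarrow> nat \<Rightarrow> complex poly mat topology" where
  "pol_ss_topology d m = Metric_space.mtopology (pol_ss d m) (pol_dist d m)"

text \<open>
  The degrees \<open>ds 1, \<dots>, ds r\<close> are indexed from 1: the \<open>i\<close>-th column of \<open>L\<close> is \<open>col L (i - 1)\<close>
  and the \<open>(2 * r - i + 1)\<close>-th column is \<open>col L (2 * r - i)\<close>. The set is meant for
  \<open>d / 2 \<le> ds i \<le> d\<close> only, where \<open>d - ds i\<close> is not truncated.
\<close>

definition skew_fact_set :: "nat \<Rightarrow> nat \<Rightarrow> nat \<Rightarrow> (nat \<Rightarrow> nat) \<Rightarrow> complex poly mat set" where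
  "skew_fact_set m d r ds =
     {L * skew_block_mat r * transpose_mat L | L.
        L \<in> carrier_mat m (2 * r) \<and>
        (\<forall>i\<in>{1..r}. has_vec_degree (col L (i - 1)) (ds i) \<and>
                    has_vec_degree (col L (2 * r - i)) (d - ds i))}"

lemma pol_dist_L2_set:
  "pol_dist d m P Q =
     L2_set (\<lambda>(k, i, j). cmod (coeff (P $$ (i, j)) k - coeff (Q $$ (i, j)) k))
       ({..d} \<times> {..<m} \<times> {..<m})"
  unfolding pol_dist_def L2_set_def
  by (simp add: sum.cartesian_product case_prod_unfold)

lemma Metric_space_pol_ss: "Metric_space (pol_ss d m) (pol_dist d m)"
proof
  fix P Q :: "complex poly mat"
  show "0 \<le> pol_dist d m P Q"
    by (simp add: pol_dist_L2_set)
  show "pol_dist d m P Q = pol_dist d m Q P"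
    by (simp add: pol_dist_def norm_minus_commute)
next
  fix P Q assume P: "P \<in> pol_ss d m" and Q: "Q \<in> pol_ss d m"
  have high: "coeff (R $$ (i, j)) k = 0"
    if "R \<in> pol_ss d m" "i < m" "j < m" "k > d" for R i j k
  proof -
    have R: "R \<in> carrier_mat m m" and zero: "coeff_mat R k = 0\<^sub>m m m"
      using that by (auto simp: pol_ss_def)
    have "coeff (R $$ (i, j)) k = coeff_mat R k $$ (i, j)"
      using R that(2,3) by (simp add: coeff_mat_def)
    with zero show ?thesis
      using that(2,3) by simp
  qed
  show "pol_dist d m P Q = 0 \<longleftrightarrow> P = Q"
  proof
    assume "pol_dist d m P Q = 0"
    then have low: "coeff (P $$ (i, j)) k = coeff (Q $$ (i, j)) k"
      if "i < m" "j < m" "k \<le> d" for i j k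
      using that by (auto simp: pol_dist_L2_set L2_set_eq_0_iff)
    have "P $$ (i, j) = Q $$ (i, j)" if "i < m" "j < m" for i j
    proof (rule poly_eqI)
      show "coeff (P $$ (i, j)) k = coeff (Q $$ (i, j)) k" for k
        using that low high[OF P] high[OF Q] by (cases "k \<le> d") auto
    qed
    with P Q show "P = Q"
      by (intro eq_matI) (auto simp: pol_ss_def)
  qed (simp add: pol_dist_def)
next
  fix P Q R :: "complex poly mat"
  let ?f = "\<lambda>P Q (k, i, j). cmod (coeff (P $$ (i, j)) k - coeff (Q $$ (i, j)) k)"
  let ?A = "{..d} \<times> {..<m} \<times> {..<m}"
  have "L2_set (?f P R) ?A \<le> L2_set (\<lambda>x. ?f P Q x + ?f Q R x) ?A"
    by (rule L2_set_mono) (auto intro: norm_triangle_sub norm_diff_triangle_le)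
  also have "\<dots> \<le> L2_set (?f P Q) ?A + L2_set (?f Q R) ?A"
    by (rule L2_set_triangle_ineq)
  finally show "pol_dist d m P R \<le> pol_dist d m P Q + pol_dist d m Q R"
    by (simp only: pol_dist_L2_set)
qed

end

theory Submission
  imports Defs
begin

text \<open>
  The product \<open>L J L\<^sup>T\<close> is a sum of \<open>r\<close> wedges \<open>u v\<^sup>T - v u\<^sup>T\<close> of pairs of columns of \<open>L\<close>, so each
  pair may be balanced separately. If \<open>deg u = a\<close>, \<open>deg v = b\<close> and \<open>b + 2 \<le> a\<close>, let \<open>u\<^sub>a\<close> be the leading
  coefficient of \<open>u\<close> and put \<open>v' = v + \<epsilon> \<lambda>\<^bsup>b+1\<^esup> u\<^sub>a\<close> and \<open>u' = u - \<epsilon>\<^sup>-\<^sup>1 \<lambda>\<^bsup>a-b-1\<^esup> v'\<close>. Then \<open>u'\<close> and \<open>v'\<close> have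
  degrees \<open>a - 1\<close> and \<open>b + 1\<close> for small \<open>\<epsilon> \<noteq> 0\<close>, and the wedge of \<open>u'\<close> and \<open>v'\<close> equals that of \<open>u\<close> and
  \<open>v'\<close>, which tends to that of \<open>u\<close> and \<open>v\<close>. Iterating moves all degrees to \<open>\<lceil>d/2\<rceil>\<close> and \<open>\<lfloor>d/2\<rfloor>\<close>.
\<close>

section \<open>Wedges of vector polynomials and their degrees\<close>

unbundle no vec_syntax

text \<open>The wedge \<open>u v\<^sup>T - v u\<^sup>T\<close> is handled entry by entry, so that
  degree and distance estimates reduce to scalar polynomials.\<close>

definition wedge_entry :: "complex poly vec \<Rightarrow> complex poly vec \<Rightarrow> nat \<Rightarrow> nat \<Rightarrow> complex poly" where
  "wedge_entry u v i j = u $ i * v $ j - v $ i * u $ j"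

lemma has_vec_degree_iff:
  "has_vec_degree v n \<longleftrightarrow>
     (\<exists>i<dim_vec v. coeff (v $ i) n \<noteq> 0) \<and> (\<forall>k>n. \<forall>i<dim_vec v. coeff (v $ i) k = 0)"
  unfolding has_vec_degree_def coeff_vec_def by (auto simp: vec_eq_iff)

lemma has_vec_degree_imp_degree_le:
  assumes "has_vec_degree v n" "i < dim_vec v"
  shows "degree (v $ i) \<le> n"
  using assms by (auto simp: has_vec_degree_iff intro: degree_le)

lemma degree_wedge_entry_le:
  assumes "has_vec_degree u a" "has_vec_degree v b"
    and "dim_vec u = m" "dim_vec v = m" "i < m" "j < m"
  shows "degree (wedge_entry u v i j) \<le> a + b"
  unfolding wedge_entry_def
proof (rule degree_diff_le)
  have deg: "degree (u $ l) \<le> a" "degree (v $ l) \<le> b" if "l < m" for l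
    using assms that by (auto intro: has_vec_degree_imp_degree_le)
  show "degree (u $ i * v $ j) \<le> a + b"
    using degree_mult_le[of "u $ i" "v $ j"] deg(1)[OF assms(5)] deg(2)[OF assms(6)] by linarith
  show "degree (v $ i * u $ j) \<le> a + b"
    using degree_mult_le[of "v $ i" "u $ j"] deg(2)[OF assms(5)] deg(1)[OF assms(6)] by linarith
qed

section \<open>Balancing the degrees of one pair of columns\<close>

lemma wedge_balance_step:
  fixes u v :: "complex poly vec"
  assumes u: "dim_vec u = m" "has_vec_degree u a"
    and v: "dim_vec v = m" "has_vec_degree v b"
    and ab: "b + 2 \<le> a" and e: "0 < e"
  obtains u' v' where "dim_vec u' = m" "has_vec_degree u' (a - 1)"
    and "dim_vec v' = m" "has_vec_degree v' (b + 1)"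
    and "\<And>i j k. \<lbrakk>i < m; j < m; k \<le> d\<rbrakk> \<Longrightarrow>
           cmod (coeff (wedge_entry u' v' i j) k - coeff (wedge_entry u v i j) k) < e"
proof -
  \<comment> \<open>Wedge of \<open>u\<close> with its leading coefficient;
    \<open>monom \<epsilon> (b + 1) * q i j\<close> will be the exact change of the wedge
    entry.\<close>
  define q where "q i j = u $ i * [:coeff (u $ j) a:] - u $ j * [:coeff (u $ i) a:]" for i j
  \<comment> \<open>Row \<open>s\<close> witnesses the degree of \<open>u'\<close>: its coefficient
    at \<open>a - 1\<close> will be that of \<open>u\<close> minus
    \<open>coeff (v $ s) b / \<epsilon>\<close>, which is nonzero for small \<epsilon>.\<close>
  obtain s where s: "s < m" "coeff (v $ s) b \<noteq> 0"
    using v by (auto simp: has_vec_degree_iff)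
  have ev1: "\<forall>\<^sub>F \<epsilon> in at 0. \<epsilon> * coeff (u $ s) (a - 1) - coeff (v $ s) b \<noteq> 0"
  proof (rule tendsto_imp_eventually_ne)
    show "((\<lambda>\<epsilon>. \<epsilon> * coeff (u $ s) (a - 1) - coeff (v $ s) b) \<longlongrightarrow>
             0 * coeff (u $ s) (a - 1) - coeff (v $ s) b) (at 0)"
      by (intro tendsto_intros)
  qed (use s in auto)
  have small: "\<forall>\<^sub>F \<epsilon> in at 0. cmod (coeff (monom \<epsilon> (b + 1) * q i j) k) < e" for i j k
  proof -
    have "((\<lambda>\<epsilon>. cmod (\<epsilon> * coeff (q i j) (k - (b + 1)))) \<longlongrightarrow>
             cmod (0 * coeff (q i j) (k - (b + 1)))) (at 0)"
      by (intro tendsto_intros)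
    then have "\<forall>\<^sub>F \<epsilon> in at 0. cmod (\<epsilon> * coeff (q i j) (k - (b + 1))) < e"
      using e by (auto dest: order_tendstoD(2))
    then show ?thesis
      by eventually_elim (use e in \<open>auto simp: coeff_monom_mult\<close>)
  qed
  \<comment> \<open>Only finitely many entries and exponents up to \<open>d\<close> matter, so a
    single \<epsilon> can serve them all.\<close>
  have ev2: "\<forall>\<^sub>F \<epsilon> in at 0. \<forall>i\<in>{..<m}. \<forall>j\<in>{..<m}. \<forall>k\<in>{..d}.
               cmod (coeff (monom \<epsilon> (b + 1) * q i j) k) < e"
    by (intro eventually_ball_finite ballI small) auto
  have "\<forall>\<^sub>F \<epsilon> in at (0::complex). \<epsilon> \<noteq> 0"
    by (simp add: eventually_at_filter)
  with ev1 ev2 have "\<forall>\<^sub>F \<epsilon> in at 0. \<epsilon> \<noteq> 0 \<and> \<epsilon> * coeff (u $ s) (a - 1) - coeff (v $ s) b \<noteq> 0 \<and>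
     (\<forall>i\<in>{..<m}. \<forall>j\<in>{..<m}. \<forall>k\<in>{..d}. cmod (coeff (monom \<epsilon> (b + 1) * q i j) k) < e)"
    by eventually_elim simp
  from eventually_happens'[OF trivial_limit_at this] obtain \<epsilon> where \<epsilon>: "\<epsilon> \<noteq> 0" "\<epsilon> * coeff (u $ s) (a - 1) \<noteq> coeff (v $ s) b"
    and close: "\<And>i j k. \<lbrakk>i < m; j < m; k \<le> d\<rbrakk> \<Longrightarrow> cmod (coeff (monom \<epsilon> (b + 1) * q i j) k) < e"
    by auto
  define v' where "v' = vec m (\<lambda>i. v $ i + monom (\<epsilon> * coeff (u $ i) a) (b + 1))"
  define u' where "u' = vec m (\<lambda>i. u $ i - monom (1 / \<epsilon>) (a - b - 1) * v' $ i)"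
  have v0: "coeff (v $ i) k = 0" if "i < m" "k > b" for i k
    using v that by (auto simp: has_vec_degree_iff)
  have u0: "coeff (u $ i) k = 0" if "i < m" "k > a" for i k
    using u that by (auto simp: has_vec_degree_iff)
  show thesis
  proof (rule that)
    show "dim_vec u' = m" "dim_vec v' = m"
      by (simp_all add: u'_def v'_def)
    show "has_vec_degree v' (b + 1)"
      using u v0 \<epsilon>(1) by (auto simp: has_vec_degree_iff v'_def)
    \<comment> \<open>The shift by \<open>a - b - 1\<close> moves the new top term of
      \<open>v'\<close> from exponent \<open>b + 1\<close> to \<open>a\<close>, where it cancels the
      leading coefficient of \<open>u\<close>.\<close>
    have cu: "coeff (u' $ i) k = coeff (u $ i) k - (if k < a - b - 1 then 0 else
        coeff (v $ i) (k - (a - b - 1)) / \<epsilon> + (if k = a then coeff (u $ i) a else 0))"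
      if "i < m" for i k
    proof -
      have "coeff (v' $ i) n = coeff (v $ i) n + (if n = b + 1 then \<epsilon> * coeff (u $ i) a else 0)" for n
        using that by (simp add: v'_def)
      moreover have "k - (a - b - 1) = b + 1 \<longleftrightarrow> k = a" using ab by auto
      moreover have "coeff (u' $ i) k = coeff (u $ i) k -
          (if k < a - b - 1 then 0 else 1 / \<epsilon> * coeff (v' $ i) (k - (a - b - 1)))"
        using that by (simp only: u'_def index_vec coeff_diff coeff_monom_mult)
      ultimately show ?thesis
        using \<epsilon>(1) by (simp add: add_divide_distrib)
    qed
    have "coeff (u' $ s) (a - 1) \<noteq> 0"
    proof -
      have "a - 1 - (a - b - 1) = b" using ab by auto
      then have "coeff (u' $ s) (a - 1) = coeff (u $ s) (a - 1) - coeff (v $ s) b / \<epsilon>"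
        using cu[OF s(1), of "a - 1"] ab by auto
      then show ?thesis using \<epsilon> by (auto simp: field_simps)
    qed
    moreover have "coeff (u' $ i) k = 0" if "i < m" "k > a - 1" for i k
    proof -
      have "k - (a - b - 1) > b" using that ab by auto
      then show ?thesis
        using cu[OF that(1), of k] u0[OF that(1), of k] v0[OF that(1)] that by auto
    qed
    ultimately show "has_vec_degree u' (a - 1)"
      using s(1) by (auto simp: has_vec_degree_iff u'_def)
    fix i j k assume ijk: "i < m" "j < m" "k \<le> d"
    have mon: "monom (\<epsilon> * c) (b + 1) = monom \<epsilon> (b + 1) * [:c:]" for c
      by (simp add: smult_monom mult.commute)
    \<comment> \<open>Subtracting a multiple of \<open>v'\<close> from \<open>u\<close> leaves the
      wedge with \<open>v'\<close> unchanged, so only the change from \<open>v\<close> to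
      \<open>v'\<close> remains.\<close>
    have "wedge_entry u' v' i j - wedge_entry u v i j =
        u $ i * (v' $ j - v $ j) - (v' $ i - v $ i) * u $ j"
      using ijk by (simp add: wedge_entry_def u'_def algebra_simps)
    also have "\<dots> = monom \<epsilon> (b + 1) * q i j"
      using ijk unfolding v'_def q_def by (simp only: index_vec mon) (simp add: algebra_simps)
    finally show "cmod (coeff (wedge_entry u' v' i j) k - coeff (wedge_entry u v i j) k) < e"
      using close[OF ijk] by (simp flip: coeff_diff)
  qed
qed

text \<open>Iterates the single step. The bound \<open>b + 2 * n \<le> a\<close> guarantees a gap of
  at least two before each of the \<open>n\<close> steps; the first step takes half of the tolerance
  and the rest share the other half.\<close>

lemma wedge_balance:
  fixes u v :: "complex poly vec"
  assumes "dim_vec u = m" "has_vec_degree u a"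
    and "dim_vec v = m" "has_vec_degree v b"
    and "b + 2 * n \<le> a" "0 < e"
  shows "\<exists>u' v'. dim_vec u' = m \<and> has_vec_degree u' (a - n) \<and>
    dim_vec v' = m \<and> has_vec_degree v' (b + n) \<and>
    (\<forall>i<m. \<forall>j<m. \<forall>k\<le>d.
       cmod (coeff (wedge_entry u' v' i j) k - coeff (wedge_entry u v i j) k) < e)"
  using assms
proof (induction n arbitrary: u v a b e)
  case 0
  then show ?case by (intro exI[of _ u] exI[of _ v]) auto
next
  case (Suc n)
  have "b + 2 \<le> a" "0 < e / 2" using Suc.prems by auto
  from wedge_balance_step[OF Suc.prems(1-4) this, where d = d] obtain u1 v1 where
    1: "dim_vec u1 = m" "has_vec_degree u1 (a - 1)" "dim_vec v1 = m" "has_vec_degree v1 (b + 1)"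
    and close1: "\<And>i j k. \<lbrakk>i < m; j < m; k \<le> d\<rbrakk> \<Longrightarrow>
       cmod (coeff (wedge_entry u1 v1 i j) k - coeff (wedge_entry u v i j) k) < e / 2"
    by metis
  have "b + 1 + 2 * n \<le> a - 1" using Suc.prems by auto
  from Suc.IH[OF 1 this \<open>0 < e / 2\<close>] obtain u2 v2 where
    2: "dim_vec u2 = m" "has_vec_degree u2 (a - 1 - n)"
      "dim_vec v2 = m" "has_vec_degree v2 (b + 1 + n)"
    and close2: "\<And>i j k. \<lbrakk>i < m; j < m; k \<le> d\<rbrakk> \<Longrightarrow>
       cmod (coeff (wedge_entry u2 v2 i j) k - coeff (wedge_entry u1 v1 i j) k) < e / 2"
    by metis
  have "cmod (coeff (wedge_entry u2 v2 i j) k - coeff (wedge_entry u v i j) k) < e"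
    if "i < m" "j < m" "k \<le> d" for i j k
    using norm_diff_triangle_less[OF close2[OF that] close1[OF that]] by simp
  with 2 show ?case
    by (intro exI[of _ u2] exI[of _ v2]) auto
qed

section \<open>The product as a sum of wedges\<close>

lemma skew_block_mat_index:
  assumes "k < 2 * r" "l < 2 * r"
  shows "skew_block_mat r $$ (k, l) =
    (if k = 2 * r - 1 - l then (if l < r then - 1 else 1) else 0)"
  using assms by (auto simp: skew_block_mat_def antidiag_mat_def)

text \<open>Each column of the block matrix has one nonzero entry, so column \<open>k\<close> of
  \<open>L\<close> meets only column \<open>2 * r - 1 - k\<close>.\<close>

lemma skew_product_index:
  assumes L: "L \<in> carrier_mat m (2 * r)" and ij: "i < m" "j < m"
  shows "(L * skew_block_mat r * transpose_mat L) $$ (i, j) =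
    (\<Sum>k<r. wedge_entry (col L k) (col L (2 * r - 1 - k)) i j)"
proof -
  have J: "skew_block_mat r \<in> carrier_mat (2 * r) (2 * r)"
    by (auto simp: skew_block_mat_def antidiag_mat_def)
  have LJ: "(L * skew_block_mat r) $$ (i, l) =
      L $$ (i, 2 * r - 1 - l) * (if l < r then - 1 else 1)" if "l < 2 * r" for l
  proof -
    have "(L * skew_block_mat r) $$ (i, l) =
        (\<Sum>k<2 * r. L $$ (i, k) * skew_block_mat r $$ (k, l))"
      using L J ij that by (simp add: scalar_prod_def lessThan_atLeast0)
    also have "\<dots> = (\<Sum>k<2 * r. if k = 2 * r - 1 - l
        then L $$ (i, k) * (if l < r then - 1 else 1) else 0)"
      using that by (intro sum.cong) (auto simp: skew_block_mat_index)
    also have "\<dots> = L $$ (i, 2 * r - 1 - l) * (if l < r then - 1 else 1)"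
      using that by (subst sum.delta) auto
    finally show ?thesis .
  qed
  let ?f = "\<lambda>l. L $$ (i, 2 * r - 1 - l) * (if l < r then - 1 else 1) * L $$ (j, l)"
  have "(L * skew_block_mat r * transpose_mat L) $$ (i, j) =
      (\<Sum>l<2 * r. (L * skew_block_mat r) $$ (i, l) * L $$ (j, l))"
    using L J ij
    by (simp add: scalar_prod_def lessThan_atLeast0 del: assoc_mult_mat index_mult_mat(1))
      (simp add: times_mat_def scalar_prod_def)
  also have "\<dots> = sum ?f {..<2 * r}"
    by (intro sum.cong) (auto simp: LJ)
  \<comment> \<open>The indices below \<open>r\<close> give the negative terms of the wedges; the
    others, reflected by \<open>2 * r - 1 - k\<close>, give the positive terms.\<close>
  also have "{..<2 * r} = {..<r} \<union> {r..<2 * r}" by auto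
  also have "sum ?f \<dots> = sum ?f {..<r} + sum ?f {r..<2 * r}"
    by (intro sum.union_disjoint) auto
  also have "sum ?f {r..<2 * r} = (\<Sum>k<r. L $$ (i, k) * L $$ (j, 2 * r - 1 - k))"
    by (rule sum.reindex_bij_witness[of _ "\<lambda>k. 2 * r - 1 - k" "\<lambda>k. 2 * r - 1 - k"]) auto
  also have "sum ?f {..<r} = (\<Sum>k<r. - (L $$ (i, 2 * r - 1 - k) * L $$ (j, k)))"
    by (intro sum.cong) auto
  also have "\<dots> + (\<Sum>k<r. L $$ (i, k) * L $$ (j, 2 * r - 1 - k)) =
      (\<Sum>k<r. wedge_entry (col L k) (col L (2 * r - 1 - k)) i j)"
    unfolding sum.distrib[symmetric]
    using L ij by (intro sum.cong) (auto simp: wedge_entry_def)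
  finally show ?thesis .
qed

section \<open>The factorization sets inside the space of skew-symmetric polynomials\<close>

lemma skew_fact_setE:
  assumes "P \<in> skew_fact_set m d r ds"
  obtains L where "P = L * skew_block_mat r * transpose_mat L" "L \<in> carrier_mat m (2 * r)"
    and "\<And>k. k < r \<Longrightarrow> has_vec_degree (col L k) (ds (Suc k))"
    and "\<And>k. k < r \<Longrightarrow> has_vec_degree (col L (2 * r - 1 - k)) (d - ds (Suc k))"
proof -
  obtain L where L: "P = L * skew_block_mat r * transpose_mat L" "L \<in> carrier_mat m (2 * r)"
    and deg: "\<forall>i\<in>{1..r}. has_vec_degree (col L (i - 1)) (ds i) \<and>
                    has_vec_degree (col L (2 * r - i)) (d - ds i)"
    using assms unfolding skew_fact_set_def by blast
  show thesis
  proof (rule that[OF L])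
    fix k assume "k < r"
    then show "has_vec_degree (col L k) (ds (Suc k))"
      "has_vec_degree (col L (2 * r - 1 - k)) (d - ds (Suc k))"
      using deg[rule_format, of "Suc k"] by auto
  qed
qed

text \<open>Wedges are skew-symmetric, and paired degrees add up to \<open>d\<close> because
  \<open>ds i \<le> d\<close> rules out truncated subtraction. This puts both the given point and
  its approximations into the carrier of the metric.\<close>

lemma skew_fact_set_subset_pol_ss:
  assumes "\<And>i. i \<in> {1..r} \<Longrightarrow> ds i \<le> d"
  shows "skew_fact_set m d r ds \<subseteq> pol_ss d m"
proof
  fix P assume "P \<in> skew_fact_set m d r ds"
  then obtain L where P: "P = L * skew_block_mat r * transpose_mat L"
    and L: "L \<in> carrier_mat m (2 * r)"
    and deg: "\<And>k. k < r \<Longrightarrow> has_vec_degree (col L k) (ds (Suc k))"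
      "\<And>k. k < r \<Longrightarrow> has_vec_degree (col L (2 * r - 1 - k)) (d - ds (Suc k))"
    by (rule skew_fact_setE) metis
  have entry: "P $$ (i, j) = (\<Sum>k<r. wedge_entry (col L k) (col L (2 * r - 1 - k)) i j)"
    if "i < m" "j < m" for i j
    using skew_product_index[OF L that] P by simp
  have Pc: "P \<in> carrier_mat m m" using P L by auto
  have skew: "P $$ (j, i) = - P $$ (i, j)" if "i < m" "j < m" for i j
    using that by (simp add: entry wedge_entry_def algebra_simps flip: sum_negf)
  have "degree (P $$ (i, j)) \<le> d" if "i < m" "j < m" for i j
    unfolding entry[OF that]
  proof (rule degree_sum_le)
    fix k assume "k \<in> {..<r}"
    then show "degree (wedge_entry (col L k) (col L (2 * r - 1 - k)) i j) \<le> d"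
      using degree_wedge_entry_le[OF deg, of k k m i j] assms[of "Suc k"] L that by auto
  qed simp
  then have high: "coeff (P $$ (i, j)) k = 0" if "i < m" "j < m" "k > d" for i j k
    using that by (meson coeff_eq_0 le_less_trans)
  have "transpose_mat (coeff_mat P k) = - coeff_mat P k" for k
  proof (rule eq_matI)
    fix i j assume "i < dim_row (- coeff_mat P k)" "j < dim_col (- coeff_mat P k)"
    then have "i < m" "j < m" using Pc by (auto simp: coeff_mat_def)
    then show "transpose_mat (coeff_mat P k) $$ (i, j) = (- coeff_mat P k) $$ (i, j)"
      using Pc skew[of i j] by (simp add: coeff_mat_def)
  qed (use Pc in \<open>auto simp: coeff_mat_def\<close>)
  moreover have "coeff_mat P k = 0\<^sub>m m m" if "k > d" for k
    using Pc high that by (intro eq_matI) (simp_all add: coeff_mat_def)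
  ultimately show "P \<in> pol_ss d m"
    using Pc by (simp add: pol_ss_def)
qed

section \<open>Distance estimate and the closure statement\<close>

lemma pol_dist_less:
  assumes close: "\<And>i j k. \<lbrakk>i < m; j < m; k \<le> d\<rbrakk> \<Longrightarrow>
      cmod (coeff (P $$ (i, j)) k - coeff (Q $$ (i, j)) k) \<le> \<delta>"
    and small: "real ((d + 1) * (m * m)) * \<delta> < e"
  shows "pol_dist d m P Q < e"
proof -
  let ?A = "{..d} \<times> {..<m} \<times> {..<m}"
  \<comment> \<open>The Euclidean norm is at most the sum of the absolute values, which has
    \<open>(d + 1) * (m * m)\<close> terms.\<close>
  have "pol_dist d m P Q \<le>
      (\<Sum>(k, i, j)\<in>?A. cmod (coeff (P $$ (i, j)) k - coeff (Q $$ (i, j)) k))"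
    unfolding pol_dist_L2_set by (rule L2_set_le_sum) auto
  also have "\<dots> \<le> of_nat (card ?A) * \<delta>"
    by (rule sum_bounded_above) (auto intro: close)
  also have "\<dots> < e"
    using small by (simp add: card_cartesian_product)
  finally show ?thesis .
qed

lemma nat_ceiling_half: "nat \<lceil>real d / 2\<rceil> = (d + 1) div 2"
  by linarith

theorem theorem3p7:
  fixes m r d :: nat and ds :: "nat \<Rightarrow> nat"
  assumes "1 \<le> d"
    and "2 \<le> 2 * r" and "2 * r + 1 \<le> m"
    and "\<And>i. i \<in> {1..r} \<Longrightarrow> ds i \<le> d \<and> real (ds i) \<ge> real d / 2"
  shows "skew_fact_set m d r ds \<subseteq>
           pol_ss_topology d m closure_of skew_fact_set m d r (\<lambda>_. nat \<lceil>real d / 2\<rceil>)"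
proof
  define c where "c = (d + 1) div 2"
  have ds: "ds (Suc k) \<le> d" "c \<le> ds (Suc k)" if "k < r" for k
    using assms(4)[of "Suc k"] that unfolding c_def by auto
  fix P assume P_in: "P \<in> skew_fact_set m d r ds"
  then obtain L where P: "P = L * skew_block_mat r * transpose_mat L"
    and L: "L \<in> carrier_mat m (2 * r)"
    and deg: "\<And>k. k < r \<Longrightarrow> has_vec_degree (col L k) (ds (Suc k))"
      "\<And>k. k < r \<Longrightarrow> has_vec_degree (col L (2 * r - 1 - k)) (d - ds (Suc k))"
    by (rule skew_fact_setE) metis
  have P_ss: "P \<in> pol_ss d m"
    using P_in skew_fact_set_subset_pol_ss[of r ds d m] assms(4) by auto
  interpret Metric_space "pol_ss d m" "pol_dist d m"
    by (rule Metric_space_pol_ss)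
  have "\<exists>Q\<in>skew_fact_set m d r (\<lambda>_. c). Q \<in> mball P e" if e: "0 < e" for e
  proof -
    \<comment> \<open>\<open>N\<close> counts the coefficients of a matrix once per column pair.
      Dividing by \<open>N + 1\<close> avoids a zero denominator and makes
      \<open>N * \<delta> < e\<close> strict.\<close>
    define N where "N = real ((d + 1) * (m * m) * r)"
    define \<delta> where "\<delta> = e / (N + 1)"
    have N: "0 \<le> N" by (simp add: N_def)
    have \<delta>: "0 < \<delta>" "N * \<delta> < e"
      using e N by (auto simp: \<delta>_def field_simps)
    have "\<exists>u' v'. dim_vec u' = m \<and> has_vec_degree u' c \<and>
        dim_vec v' = m \<and> has_vec_degree v' (d - c) \<and>
        (\<forall>i<m. \<forall>j<m. \<forall>l\<le>d. cmod (coeff (wedge_entry u' v' i j) l -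
           coeff (wedge_entry (col L k) (col L (2 * r - 1 - k)) i j) l) < \<delta>)" if k: "k < r" for k
    proof -
      \<comment> \<open>The pair needs \<open>ds (Suc k) - c\<close> steps; there is room for them
        because \<open>d \<le> 2 * c\<close>.\<close>
      have n: "d - ds (Suc k) + 2 * (ds (Suc k) - c) \<le> ds (Suc k)"
        "ds (Suc k) - (ds (Suc k) - c) = c" "d - ds (Suc k) + (ds (Suc k) - c) = d - c"
        using ds[OF k] unfolding c_def by auto
      have dims: "dim_vec (col L k) = m" "dim_vec (col L (2 * r - 1 - k)) = m"
        using L by auto
      show ?thesis
        using wedge_balance[OF dims(1) deg(1)[OF k] dims(2) deg(2)[OF k] n(1) \<delta>(1), of d]
        unfolding n(2,3) .
    qed
    then obtain U V where UV: "\<And>k. k < r \<Longrightarrow> dim_vec (U k) = m \<and> has_vec_degree (U k) c \<and>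
        dim_vec (V k) = m \<and> has_vec_degree (V k) (d - c)"
      and close: "\<And>k i j l. \<lbrakk>k < r; i < m; j < m; l \<le> d\<rbrakk> \<Longrightarrow>
        cmod (coeff (wedge_entry (U k) (V k) i j) l -
           coeff (wedge_entry (col L k) (col L (2 * r - 1 - k)) i j) l) < \<delta>"
      by metis
    \<comment> \<open>The second vectors are stored in reverse order, so that \<open>V k\<close>
      becomes the partner column of \<open>U k\<close>.\<close>
    define L' where "L' = mat m (2 * r)
      (\<lambda>(i, k). if k < r then U k $ i else V (2 * r - 1 - k) $ i)"
    define Q where "Q = L' * skew_block_mat r * transpose_mat L'"
    have L': "L' \<in> carrier_mat m (2 * r)" by (simp add: L'_def)
    have cols: "col L' k = U k" "col L' (2 * r - 1 - k) = V k" if "k < r" for k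
      using that UV[OF that] by (auto simp: L'_def intro!: eq_vecI)
    have Q_in: "Q \<in> skew_fact_set m d r (\<lambda>_. c)"
      unfolding skew_fact_set_def
    proof (intro CollectI exI[of _ L'] conjI ballI)
      fix i assume i: "i \<in> {1..r}"
      then obtain k where k: "i = Suc k" "k < r"
        by (cases i) auto
      show "has_vec_degree (col L' (i - 1)) c" "has_vec_degree (col L' (2 * r - i)) (d - c)"
        using cols[OF k(2)] UV[OF k(2)] by (simp_all add: k(1))
    qed (use L' Q_def in auto)
    have "c \<le> d" using assms(1) unfolding c_def by linarith
    then have Q_ss: "Q \<in> pol_ss d m"
      using Q_in skew_fact_set_subset_pol_ss[of r "\<lambda>_. c" d m] by auto
    have "pol_dist d m P Q < e"
    proof (rule pol_dist_less)
      show "real ((d + 1) * (m * m)) * (real r * \<delta>) < e"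
        using \<delta>(2) by (simp add: N_def mult.assoc)
      fix i j l assume ijl: "i < m" "j < m" "l \<le> d"
      have "coeff (P $$ (i, j)) l - coeff (Q $$ (i, j)) l =
          (\<Sum>k<r. coeff (wedge_entry (col L k) (col L (2 * r - 1 - k)) i j) l -
             coeff (wedge_entry (U k) (V k) i j) l)"
        unfolding P Q_def skew_product_index[OF L ijl(1,2)] skew_product_index[OF L' ijl(1,2)]
        by (simp only: coeff_sum sum_subtractf[symmetric])
          (intro sum.cong refl, simp only: cols lessThan_iff)
      \<comment> \<open>Each of the \<open>r\<close> pairs contributes an error of at most \<delta>
        to a coefficient.\<close>
      also have "cmod \<dots> \<le> of_nat (card {..<r}) * \<delta>"
        using close ijl by (intro sum_norm_bound) (auto simp: norm_minus_commute less_imp_le)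
      finally show "cmod (coeff (P $$ (i, j)) l - coeff (Q $$ (i, j)) l) \<le> real r * \<delta>"
        by simp
    qed
    with P_ss Q_ss Q_in show ?thesis by (auto simp: in_mball)
  qed
  with P_ss show "P \<in> pol_ss_topology d m closure_of
      skew_fact_set m d r (\<lambda>_. nat \<lceil>real d / 2\<rceil>)"
    unfolding pol_ss_topology_def metric_closure_of nat_ceiling_half c_def by blast
qed

end
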